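(* Let $G$ be a finite group, and for $i=1,2$ let $H_i\le G$ and $S_i\subset G$ be such that $|H_1|=|H_2|$, $H_i\cap S_i=\emptyset$ and $H_iS_iH_i=S_i$. Then $\mathrm{Cos}(G,H_1,S_1)\cong\mathrm{Cos}(G,H_2,S_2)$ if and only if $\mathrm{Cay}(G,S_1)\cong\mathrm{Cay}(G,S_2)$.
   Context: For $H\le G$ and $S\subset G$ with $S\cap H=\emptyset$ and $HSH=S$, the double coset digraph $\mathrm{Cos}(G,H,S)$ has as vertices the left cosets of $H$ in $G$ and arc set $\{(gH,gsH):g\in G,s\in S\}$; $H$ is not required to be core-free. For $S\subset G$ with $1\notin S$, the Cayley digraph $\mathrm{Cay}(G,S)$ has vertex set $G$ and arc set $\{(g,gs):g\in G,s\in S\}$. The symbol $\cong$ denotes isomorphism of digraphs. *)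

theory Defs
  imports "HOL-Algebra.Left_Coset" "Graph_Theory.Graph_Theory"
begin

text \<open>
  Both digraphs have no parallel arcs, so they are given as \<^typ>\<open>'v pair_pre_digraph\<close>, whose
  arcs are ordered pairs of vertices. They are compared by \<^const>\<open>digraph_iso\<close> after the
  embedding \<^const>\<open>with_proj\<close> (which takes tail and head of an arc to be its first and second
  component); the lemma \<open>digraph_iso_with_proj_iff\<close> below confirms that this is the usual notion.
\<close>

definition double_coset_digraph ::
  "('a, 'm) monoid_scheme \<Rightarrow> 'a set \<Rightarrow> 'a set \<Rightarrow> 'a set pair_pre_digraph" where
  "double_coset_digraph G H S =
     \<lparr>pverts = lcosets\<^bsub>G\<^esub> H,
      parcs = {(g <#\<^bsub>G\<^esub> H, (g \<otimes>\<^bsub>G\<^esub> s) <#\<^bsub>G\<^esub> H) | g s. g \<in> carrier G \<and> s \<in> S}\<rparr>"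

definition cayley_digraph ::
  "('a, 'm) monoid_scheme \<Rightarrow> 'a set \<Rightarrow> 'a pair_pre_digraph" where
  "cayley_digraph G S =
     \<lparr>pverts = carrier G,
      parcs = {(g, g \<otimes>\<^bsub>G\<^esub> s) | g s. g \<in> carrier G \<and> s \<in> S}\<rparr>"

lemma (in group) pair_wf_double_coset_digraph:
  assumes "S \<subseteq> carrier G"
  shows "pair_wf_digraph (double_coset_digraph G H S)"
  using assms
  by unfold_locales (fastforce simp: double_coset_digraph_def LCOSETS_def intro: m_closed)+

lemma (in group) pair_wf_cayley_digraph:
  assumes "S \<subseteq> carrier G"
  shows "pair_wf_digraph (cayley_digraph G S)"
  using assms by unfold_locales (auto simp: cayley_digraph_def)

lemma digraph_iso_with_proj_iff:
  assumes "pair_wf_digraph D" and "pair_wf_digraph E"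
  shows "digraph_iso (with_proj D) (with_proj E) \<longleftrightarrow>
    (\<exists>f. bij_betw f (pverts D) (pverts E) \<and>
      (\<forall>u \<in> pverts D. \<forall>v \<in> pverts D. (u, v) \<in> parcs D \<longleftrightarrow> (f u, f v) \<in> parcs E))"
    (is "?L \<longleftrightarrow> ?R")
proof
  interpret D: pair_wf_digraph D by fact
  assume ?L
  then obtain h where h: "pre_digraph.digraph_isomorphism (with_proj D) h"
    and E: "with_proj E = app_iso h (with_proj D)"
    unfolding digraph_iso_def by blast
  let ?f = "iso_verts h" and ?a = "iso_arcs h"
  from E have V: "pverts E = ?f ` pverts D" and A: "parcs E = ?a ` parcs D"
    and t: "iso_tail h = fst" and hd: "iso_head h = snd"
    by (auto simp: app_iso_def with_proj_def)
  from h have inj: "inj_on ?f (pverts D)"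
    and ends: "\<And>e. e \<in> parcs D \<Longrightarrow> ?a e = (?f (fst e), ?f (snd e))"
    by (auto simp: pre_digraph.digraph_isomorphism_def t hd prod_eq_iff)
  have "(u, v) \<in> parcs D \<longleftrightarrow> (?f u, ?f v) \<in> parcs E"
    if "u \<in> pverts D" "v \<in> pverts D" for u v
  proof
    assume "(u, v) \<in> parcs D"
    then show "(?f u, ?f v) \<in> parcs E" using ends A by force
  next
    assume "(?f u, ?f v) \<in> parcs E"
    then obtain x y where xy: "(x, y) \<in> parcs D" "?f x = ?f u" "?f y = ?f v"
      using ends A by force
    then have "x \<in> pverts D" "y \<in> pverts D"
      using D.arc_fst_in_verts[OF xy(1)] D.arc_snd_in_verts[OF xy(1)] by auto
    with xy inj that show "(u, v) \<in> parcs D" by (auto dest: inj_onD)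
  qed
  with inj V show ?R by (intro exI[of _ ?f]) (auto simp: bij_betw_def)
next
  interpret D: pair_wf_digraph D by fact
  interpret E: pair_wf_digraph E by fact
  assume ?R
  then obtain f where b: "bij_betw f (pverts D) (pverts E)"
    and e: "\<And>u v. u \<in> pverts D \<Longrightarrow> v \<in> pverts D \<Longrightarrow> (u, v) \<in> parcs D \<longleftrightarrow> (f u, f v) \<in> parcs E"
    by blast
  let ?h = "\<lparr>iso_verts = f, iso_arcs = map_prod f f, iso_head = snd, iso_tail = fst\<rparr>"
  have in_V: "u \<in> pverts D" "v \<in> pverts D" if "(u, v) \<in> parcs D" for u v
    using D.arc_fst_in_verts[OF that] D.arc_snd_in_verts[OF that] by auto
  have "inj_on (map_prod f f) (parcs D)"
    using b in_V by (auto simp: bij_betw_def inj_on_def)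
  then have "pre_digraph.digraph_isomorphism (with_proj D) ?h"
    using b D.wf_digraph by (auto simp: pre_digraph.digraph_isomorphism_def bij_betw_def)
  moreover have "map_prod f f ` parcs D = parcs E"
  proof
    show "map_prod f f ` parcs D \<subseteq> parcs E"
    proof
      fix p assume "p \<in> map_prod f f ` parcs D"
      then obtain u v where uv: "(u, v) \<in> parcs D" "p = (f u, f v)" by auto
      with e[OF in_V[OF uv(1)]] show "p \<in> parcs E" by simp
    qed
    show "parcs E \<subseteq> map_prod f f ` parcs D"
    proof
      fix p assume p: "p \<in> parcs E"
      then have "fst p \<in> f ` pverts D" "snd p \<in> f ` pverts D"
        using E.arc_fst_in_verts[OF p] E.arc_snd_in_verts[OF p] b by (auto simp: bij_betw_def)
      then obtain u v where uv: "u \<in> pverts D" "v \<in> pverts D" "p = (f u, f v)"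
        by (metis imageE prod.collapse)
      with p e[OF uv(1,2)] have "(u, v) \<in> parcs D" by simp
      with uv(3) show "p \<in> map_prod f f ` parcs D" by (intro image_eqI[of _ _ "(u, v)"]) auto
    qed
  qed
  then have "with_proj E = app_iso ?h (with_proj D)"
    using b by (auto simp: app_iso_def with_proj_def bij_betw_def)
  ultimately show ?L unfolding digraph_iso_def by blast
qed

end

theory Submission
  imports Defs
begin

text \<open>
  Let \<open>m\<close> be the common order of \<open>H1\<close> and \<open>H2\<close>. Because \<open>S = HSH\<close>, whether \<open>x\<inverse>y \<in> S\<close> depends
  only on the cosets \<open>xH\<close> and \<open>yH\<close>. So \<open>x \<mapsto> xH\<close> exhibits the Cayley digraph as an \<open>m\<close>-fold
  blow-up of the double coset digraph: each vertex of the latter is replaced by \<open>m\<close> independent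
  copies (lemma \<open>blowup_cayley_double_coset\<close>). What remains is a fact about finite digraphs: for a
  fixed \<open>m > 0\<close>, two digraphs are isomorphic if and only if their \<open>m\<close>-fold blow-ups are.

  Both directions build a bijection that respects a labelling of the vertices, which exists once
  every label is used equally often on both sides (lemma \<open>bij_betw_respecting_labels\<close>). An
  isomorphism of the base digraphs lifts because all fibres have the same size \<open>m\<close>. Conversely, an
  isomorphism \<open>f\<close> of the blow-ups need not map fibres to fibres, since different base vertices may
  be twins, that is, have the same in- and out-neighbours. But \<open>f\<close> does respect neighbourhoods. So
  a base vertex is labelled by its pair of neighbourhoods, read off in the second blow-up; a label
  is used by \<open>m\<close> times as many vertices of the blow-up as of the base, and dividing
  by \<open>m\<close> shows that it is used equally often in both bases. A bijection that respects these labels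
  is an isomorphism, since twins can be exchanged without changing the digraph.
\<close>

section \<open>Bijections that respect labels\<close>

lemma bij_betw_respecting_labels:
  assumes fin: "finite A" "finite B"
    and card: "\<And>c. card {a \<in> A. p a = c} = card {b \<in> B. q b = c}"
  shows "\<exists>h. bij_betw h A B \<and> (\<forall>a \<in> A. q (h a) = p a)"
proof -
  have "\<exists>g. bij_betw g {a \<in> A. p a = c} {b \<in> B. q b = c}" for c
    using fin card by (intro finite_same_card_bij) auto
  then obtain g where g: "\<And>c. bij_betw (g c) {a \<in> A. p a = c} {b \<in> B. q b = c}"
    by metis
  let ?h = "\<lambda>a. g (p a) a"
  have in_fibre: "?h a \<in> B \<and> q (?h a) = p a" if "a \<in> A" for a
    using bij_betwE[OF g[of "p a"]] that by auto
  have "inj_on ?h A"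
  proof (rule inj_onI)
    fix a a' assume a: "a \<in> A" "a' \<in> A" "?h a = ?h a'"
    then have "p a = p a'" using in_fibre by metis
    with a show "a = a'"
      using bij_betw_imp_inj_on[OF g[of "p a"]] by (auto dest: inj_onD)
  qed
  moreover have "B \<subseteq> ?h ` A"
  proof
    fix b assume "b \<in> B"
    then have "b \<in> g (q b) ` {a \<in> A. p a = q b}"
      using bij_betw_imp_surj_on[OF g[of "q b"]] by auto
    then obtain a where "b = g (q b) a" "a \<in> A" "p a = q b" by blast
    then show "b \<in> ?h ` A" by (intro image_eqI[of _ _ a]) auto
  qed
  ultimately show ?thesis using in_fibre by (auto simp: bij_betw_def)
qed

section \<open>Blow-ups of digraphs\<close>

text \<open>
  The blow-up is the lexicographic product of \<open>E\<close> with an arcless digraph on \<open>m\<close> vertices,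
  described by its projection \<open>p\<close> instead of by pairs, so that cosets can serve as fibres without a
  choice of coset representatives.
\<close>

definition blowup :: "nat \<Rightarrow> ('w \<Rightarrow> 'v) \<Rightarrow> 'w pair_pre_digraph \<Rightarrow> 'v pair_pre_digraph \<Rightarrow> bool" where
  "blowup m p D E \<longleftrightarrow> p ` pverts D \<subseteq> pverts E \<and>
     (\<forall>v \<in> pverts E. card {x \<in> pverts D. p x = v} = m) \<and>
     (\<forall>x \<in> pverts D. \<forall>y \<in> pverts D. (x, y) \<in> parcs D \<longleftrightarrow> (p x, p y) \<in> parcs E)"

lemma blowup_image:
  assumes "blowup m p D E" and "m > 0"
  shows "p ` pverts D = pverts E"
proof
  show "p ` pverts D \<subseteq> pverts E" using assms by (simp add: blowup_def)
  show "pverts E \<subseteq> p ` pverts D"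
  proof
    fix v assume "v \<in> pverts E"
    then have "card {x \<in> pverts D. p x = v} > 0" using assms by (simp add: blowup_def)
    then show "v \<in> p ` pverts D" by (auto simp: card_gt_0_iff)
  qed
qed

lemma card_blowup_Collect:
  assumes b: "blowup m p D E" and fin: "finite (pverts D)" "finite (pverts E)"
  shows "card {x \<in> pverts D. P (p x)} = m * card {v \<in> pverts E. P v}"
proof -
  have "{x \<in> pverts D. P (p x)} = (\<Union>v \<in> {v \<in> pverts E. P v}. {x \<in> pverts D. p x = v})"
    using b by (auto simp: blowup_def)
  then have "card {x \<in> pverts D. P (p x)} = (\<Sum>v \<in> {v \<in> pverts E. P v}. card {x \<in> pverts D. p x = v})"
    using fin by (auto intro!: card_UN_disjoint)
  also have "\<dots> = (\<Sum>v \<in> {v \<in> pverts E. P v}. m)"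
    using b by (intro sum.cong) (auto simp: blowup_def)
  finally show ?thesis by simp
qed

definition pair_iso :: "('v \<Rightarrow> 'w) \<Rightarrow> 'v pair_pre_digraph \<Rightarrow> 'w pair_pre_digraph \<Rightarrow> bool" where
  "pair_iso f D E \<longleftrightarrow> bij_betw f (pverts D) (pverts E) \<and>
     (\<forall>u \<in> pverts D. \<forall>v \<in> pverts D. (u, v) \<in> parcs D \<longleftrightarrow> (f u, f v) \<in> parcs E)"

text \<open>
  Label a vertex of each blow-up by the vertex of \<open>E2\<close> it lies over, on the left-hand side after
  applying \<open>h\<close>. Every vertex of \<open>E2\<close> is then used \<open>m\<close> times on both sides, and arcs of a blow-up
  depend only on these labels.
\<close>

lemma pair_iso_lift_to_blowup:
  assumes b1: "blowup m p1 D1 E1" and b2: "blowup m p2 D2 E2"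
    and fin: "finite (pverts D1)" "finite (pverts D2)"
    and h: "pair_iso h E1 E2"
  shows "\<exists>f. pair_iso f D1 D2"
proof -
  have hb: "bij_betw h (pverts E1) (pverts E2)" using h by (simp add: pair_iso_def)
  have p1: "p1 x \<in> pverts E1" if "x \<in> pverts D1" for x using b1 that by (auto simp: blowup_def)
  have p2: "p2 y \<in> pverts E2" if "y \<in> pverts D2" for y using b2 that by (auto simp: blowup_def)
  have "card {x \<in> pverts D1. h (p1 x) = c} = card {y \<in> pverts D2. p2 y = c}" for c
  proof (cases "c \<in> pverts E2")
    case True
    then obtain u where u: "u \<in> pverts E1" "c = h u" using hb by (auto simp: bij_betw_def)
    then have "{x \<in> pverts D1. h (p1 x) = c} = {x \<in> pverts D1. p1 x = u}"
      using hb p1 by (auto simp: bij_betw_def dest: inj_onD)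
    then show ?thesis using u True b1 b2 by (simp add: blowup_def)
  next
    case False
    then have "{x \<in> pverts D1. h (p1 x) = c} = {}" "{y \<in> pverts D2. p2 y = c} = {}"
      using p1 p2 bij_betwE[OF hb] by auto
    then show ?thesis by (metis card.empty)
  qed
  from bij_betw_respecting_labels[of "pverts D1" "pverts D2" "\<lambda>x. h (p1 x)" p2, OF fin this]
  obtain f where f: "bij_betw f (pverts D1) (pverts D2)" "\<And>x. x \<in> pverts D1 \<Longrightarrow> p2 (f x) = h (p1 x)"
    by blast
  have "(x, y) \<in> parcs D1 \<longleftrightarrow> (f x, f y) \<in> parcs D2" if xy: "x \<in> pverts D1" "y \<in> pverts D1" for x y
  proof -
    have "(x, y) \<in> parcs D1 \<longleftrightarrow> (h (p1 x), h (p1 y)) \<in> parcs E2"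
      using b1 h p1 xy by (simp add: blowup_def pair_iso_def)
    also have "\<dots> \<longleftrightarrow> (f x, f y) \<in> parcs D2"
      using b2 f(2) bij_betwE[OF f(1)] xy by (simp add: blowup_def)
    finally show ?thesis .
  qed
  with f(1) show ?thesis by (auto simp: pair_iso_def)
qed

text \<open>
  The labels \<open>l1\<close> and \<open>l2\<close> below are the pairs of neighbourhoods, as subsets of the second blow-up;
  the isomorphism \<open>f\<close> transports those of the first one there. By construction \<open>f\<close> preserves the
  labels of blow-up vertices, which gives the equality of label counts.
\<close>

lemma pair_iso_descend_from_blowup:
  assumes b1: "blowup m p1 D1 E1" and b2: "blowup m p2 D2 E2" and m: "m > 0"
    and fin: "finite (pverts D1)" "finite (pverts D2)"
    and f: "pair_iso f D1 D2"
  shows "\<exists>h. pair_iso h E1 E2"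
proof -
  have fb: "bij_betw f (pverts D1) (pverts D2)" using f by (simp add: pair_iso_def)
  note im1 = blowup_image[OF b1 m] and im2 = blowup_image[OF b2 m]
  have finE: "finite (pverts E1)" "finite (pverts E2)"
    using fin im1 im2 by (metis finite_imageI)+
  define l1 where "l1 u = (f ` {x \<in> pverts D1. (u, p1 x) \<in> parcs E1},
    f ` {x \<in> pverts D1. (p1 x, u) \<in> parcs E1})" for u
  define l2 where "l2 v = ({y \<in> pverts D2. (v, p2 y) \<in> parcs E2},
    {y \<in> pverts D2. (p2 y, v) \<in> parcs E2})" for v
  have arcs: "(p1 x, p1 x') \<in> parcs E1 \<longleftrightarrow> (p2 (f x), p2 (f x')) \<in> parcs E2"
    if "x \<in> pverts D1" "x' \<in> pverts D1" for x x'
    using that b1 b2 f bij_betwE[OF fb] by (auto simp: blowup_def pair_iso_def)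
  have lab: "l2 (p2 (f x)) = l1 (p1 x)" if x: "x \<in> pverts D1" for x
  proof -
    have "y \<in> f ` {x' \<in> pverts D1. (p1 x, p1 x') \<in> parcs E1} \<longleftrightarrow> (p2 (f x), p2 y) \<in> parcs E2"
      and "y \<in> f ` {x' \<in> pverts D1. (p1 x', p1 x) \<in> parcs E1} \<longleftrightarrow> (p2 y, p2 (f x)) \<in> parcs E2"
      if y: "y \<in> pverts D2" for y
    proof -
      obtain x' where "x' \<in> pverts D1" "y = f x'" using y fb by (auto simp: bij_betw_def)
      then show "y \<in> f ` {x' \<in> pverts D1. (p1 x, p1 x') \<in> parcs E1} \<longleftrightarrow> (p2 (f x), p2 y) \<in> parcs E2"
        and "y \<in> f ` {x' \<in> pverts D1. (p1 x', p1 x) \<in> parcs E1} \<longleftrightarrow> (p2 y, p2 (f x)) \<in> parcs E2"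
        using arcs x by auto
    qed
    then show ?thesis
      using bij_betwE[OF fb] unfolding l1_def l2_def by blast
  qed
  have "card {u \<in> pverts E1. l1 u = c} = card {v \<in> pverts E2. l2 v = c}" for c
  proof -
    have "m * card {u \<in> pverts E1. l1 u = c} = card {x \<in> pverts D1. l1 (p1 x) = c}"
      using card_blowup_Collect[OF b1 fin(1) finE(1), of "\<lambda>u. l1 u = c"] by simp
    also have "\<dots> = card {y \<in> pverts D2. l2 (p2 y) = c}"
    proof (rule bij_betw_same_card)
      show "bij_betw f {x \<in> pverts D1. l1 (p1 x) = c} {y \<in> pverts D2. l2 (p2 y) = c}"
        using bij_betw_Collect[OF fb, of "\<lambda>y. l2 (p2 y) = c" "\<lambda>x. l1 (p1 x) = c"] lab by simp
    qed
    also have "\<dots> = m * card {v \<in> pverts E2. l2 v = c}"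
      using card_blowup_Collect[OF b2 fin(2) finE(2), of "\<lambda>v. l2 v = c"] by simp
    finally show ?thesis using m by simp
  qed
  from bij_betw_respecting_labels[of "pverts E1" "pverts E2" l1 l2, OF finE this]
  obtain h where h: "bij_betw h (pverts E1) (pverts E2)" "\<And>u. u \<in> pverts E1 \<Longrightarrow> l2 (h u) = l1 u"
    by blast
  have "(u, v) \<in> parcs E1 \<longleftrightarrow> (h u, h v) \<in> parcs E2"
    if uv: "u \<in> pverts E1" "v \<in> pverts E1" for u v
  proof -
    obtain x where x: "x \<in> pverts D1" "u = p1 x" using uv im1 by auto
    obtain y where y: "y \<in> pverts D1" "v = p1 y" using uv im1 by auto
    have "h u \<in> pverts E2" using h(1) uv by (auto dest: bij_betwE)
    then obtain x' where x': "x' \<in> pverts D2" "h u = p2 x'" using im2 by auto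
    have fy: "f y \<in> pverts D2" using y bij_betwE[OF fb] by auto
    have lu: "l2 (h u) = l2 (p2 (f x))" and lv: "l2 (h v) = l2 (p2 (f y))"
      using h(2) uv lab x y by auto
    \<comment> \<open>Replace the two ends in turn: equal labels give equal out-neighbours at the tail, then equal
      in-neighbours at the head.\<close>
    have "(u, v) \<in> parcs E1 \<longleftrightarrow> (p2 (f x), p2 (f y)) \<in> parcs E2" using arcs x y by simp
    also have "\<dots> \<longleftrightarrow> f y \<in> fst (l2 (p2 (f x)))" using fy by (simp add: l2_def)
    also have "\<dots> \<longleftrightarrow> f y \<in> fst (l2 (h u))" by (simp only: lu)
    also have "\<dots> \<longleftrightarrow> (p2 x', p2 (f y)) \<in> parcs E2" using fy x' by (simp add: l2_def)
    also have "\<dots> \<longleftrightarrow> x' \<in> snd (l2 (p2 (f y)))" using x' by (simp add: l2_def)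
    also have "\<dots> \<longleftrightarrow> x' \<in> snd (l2 (h v))" by (simp only: lv)
    also have "\<dots> \<longleftrightarrow> (h u, h v) \<in> parcs E2" using x' by (simp add: l2_def)
    finally show ?thesis .
  qed
  with h(1) show ?thesis by (auto simp: pair_iso_def)
qed

section \<open>Cayley digraphs as blow-ups of double coset digraphs\<close>

context group
begin

lemma l_coset_eq_iff_mem:
  assumes "subgroup H G" and "x \<in> carrier G" and "y \<in> carrier G"
  shows "x <# H = y <# H \<longleftrightarrow> x \<in> y <# H"
  using assms l_repr_independence lcos_self by metis

lemma cayley_arc_iff:
  assumes "S \<subseteq> carrier G" and "x \<in> carrier G" and "y \<in> carrier G"
  shows "(x, y) \<in> parcs (cayley_digraph G S) \<longleftrightarrow> inv x \<otimes> y \<in> S"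
proof
  assume "(x, y) \<in> parcs (cayley_digraph G S)"
  then obtain s where "s \<in> S" "y = x \<otimes> s" by (auto simp: cayley_digraph_def)
  then show "inv x \<otimes> y \<in> S" using assms by (auto simp: m_assoc[symmetric] subset_iff)
next
  assume "inv x \<otimes> y \<in> S"
  moreover have "y = x \<otimes> (inv x \<otimes> y)" using assms by (simp add: m_assoc[symmetric])
  ultimately show "(x, y) \<in> parcs (cayley_digraph G S)"
    using assms(2) by (auto simp: cayley_digraph_def)
qed

text \<open>
  The hypothesis \<open>HSH = S\<close> is what makes an arc between two cosets come from an arc between any
  chosen representatives: another choice only multiplies \<open>s\<close> by elements of \<open>H\<close> on both sides.
\<close>

lemma blowup_cayley_double_coset:
  assumes H: "subgroup H G" and S: "S \<subseteq> carrier G" and HSH: "H <#> S <#> H = S"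
  shows "blowup (card H) (\<lambda>g. g <# H) (cayley_digraph G S) (double_coset_digraph G H S)"
  unfolding blowup_def
proof (intro conjI ballI)
  show "(\<lambda>g. g <# H) ` pverts (cayley_digraph G S) \<subseteq> pverts (double_coset_digraph G H S)"
    by (auto simp: cayley_digraph_def double_coset_digraph_def LCOSETS_def)
next
  have sub: "H \<subseteq> carrier G" using H by (rule subgroup.subset)
  fix v assume "v \<in> pverts (double_coset_digraph G H S)"
  then obtain g where g: "g \<in> carrier G" "v = g <# H"
    by (auto simp: double_coset_digraph_def LCOSETS_def)
  have "{x \<in> pverts (cayley_digraph G S). x <# H = v} = g <# H"
    using g l_coset_eq_iff_mem[OF H] l_coset_subset_G[OF sub g(1)]
    by (auto simp: cayley_digraph_def)
  also have "\<dots> = (\<lambda>h. g \<otimes> h) ` H" by (auto simp: l_coset_def)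
  finally show "card {x \<in> pverts (cayley_digraph G S). x <# H = v} = card H"
    using card_image[OF inj_on_g'[OF sub g(1)]] by simp
next
  have sub: "H \<subseteq> carrier G" using H by (rule subgroup.subset)
  fix x y assume "x \<in> pverts (cayley_digraph G S)" "y \<in> pverts (cayley_digraph G S)"
  then have xy: "x \<in> carrier G" "y \<in> carrier G" by (auto simp: cayley_digraph_def)
  show "(x, y) \<in> parcs (cayley_digraph G S) \<longleftrightarrow> (x <# H, y <# H) \<in> parcs (double_coset_digraph G H S)"
  proof
    assume "(x, y) \<in> parcs (cayley_digraph G S)"
    then show "(x <# H, y <# H) \<in> parcs (double_coset_digraph G H S)"
      by (auto simp: cayley_digraph_def double_coset_digraph_def)
  next
    assume "(x <# H, y <# H) \<in> parcs (double_coset_digraph G H S)"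
    then obtain g s where gs: "g \<in> carrier G" "s \<in> S" "x <# H = g <# H" "y <# H = (g \<otimes> s) <# H"
      by (auto simp: double_coset_digraph_def)
    have s: "s \<in> carrier G" using gs S by auto
    have "g \<in> x <# H" "y \<in> (g \<otimes> s) <# H"
      using gs s xy l_coset_eq_iff_mem[OF H] by (metis, auto)
    then obtain h k where hk: "h \<in> H" "k \<in> H" "g = x \<otimes> h" "y = g \<otimes> s \<otimes> k"
      by (auto simp: l_coset_def)
    have "inv x \<otimes> y = h \<otimes> s \<otimes> k"
      using hk xy s sub by (simp add: subset_iff m_assoc[symmetric])
    also have "\<dots> \<in> H <#> S <#> H" using hk gs by (auto simp: set_mult_def)
    finally show "(x, y) \<in> parcs (cayley_digraph G S)"
      using cayley_arc_iff[OF S xy] HSH by simp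
  qed
qed

end

theorem theorem4p13:
  fixes G :: "('a, 'm) monoid_scheme" and H1 H2 S1 S2 :: "'a set"
  assumes "group G" and "finite (carrier G)"
    and "subgroup H1 G" and "subgroup H2 G"
    and "S1 \<subseteq> carrier G" and "S2 \<subseteq> carrier G"
    and "card H1 = card H2"
    and "H1 \<inter> S1 = {}" and "H2 \<inter> S2 = {}"
    and "H1 <#>\<^bsub>G\<^esub> S1 <#>\<^bsub>G\<^esub> H1 = S1"
    and "H2 <#>\<^bsub>G\<^esub> S2 <#>\<^bsub>G\<^esub> H2 = S2"
  shows "digraph_iso (with_proj (double_coset_digraph G H1 S1)) (with_proj (double_coset_digraph G H2 S2))
    \<longleftrightarrow> digraph_iso (with_proj (cayley_digraph G S1)) (with_proj (cayley_digraph G S2))"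
proof -
  interpret group G by fact
  let ?C = "double_coset_digraph G" and ?D = "cayley_digraph G"
  have b1: "blowup (card H1) (\<lambda>g. g <#\<^bsub>G\<^esub> H1) (?D S1) (?C H1 S1)"
    and b2: "blowup (card H1) (\<lambda>g. g <#\<^bsub>G\<^esub> H2) (?D S2) (?C H2 S2)"
    using assms blowup_cayley_double_coset by (metis, metis)
  have fin: "finite (pverts (?D S1))" "finite (pverts (?D S2))"
    using assms(2) by (simp_all add: cayley_digraph_def)
  have m: "card H1 > 0"
    using assms(2,3) by (auto simp: card_gt_0_iff dest: subgroup.one_closed
        intro: finite_subset[OF subgroup.subset])
  have "(\<exists>h. pair_iso h (?C H1 S1) (?C H2 S2)) \<longleftrightarrow> (\<exists>f. pair_iso f (?D S1) (?D S2))"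
    using pair_iso_lift_to_blowup[OF b1 b2 fin] pair_iso_descend_from_blowup[OF b1 b2 m fin]
    by blast
  then show ?thesis
    using assms(5,6)
    by (simp add: digraph_iso_with_proj_iff pair_wf_double_coset_digraph pair_wf_cayley_digraph
        pair_iso_def)
qed

end
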